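(* Let $p$ be a positive integer, let $\mu$ be a probability distribution on $\mathbb{R}^{d\times d}$ with compact support, and let $A$ be a random matrix with distribution $\mu$. Assume that either (a) $p$ is even, or (b) $\operatorname{supp}\mu$ leaves a proper cone $K\subset\mathbb{R}^d$ invariant and moreover $E[A^{\otimes p}] >^{\tilde K_p} 0$. Then the stochastic switched system $\Sigma_\mu$ is $p$th mean stable if and only if it admits a homogeneous Lyapunov function of degree $p$.
   Context: The system: $\Sigma_\mu$ is the system $x(k+1)=A_kx(k)$, $k=0,1,2,\dots$, where $x(k)\in\mathbb{R}^d$ and the random matrices $A_k$ are independent, each with distribution $\mu$. Its solution with (deterministic) initial state $x(0)=x_0$ is denoted $x(\cdot;x_0)$. $\|\cdot\|$ is any fixed norm on $\mathbb{R}^d$. $\Sigma_\mu$ is $p$th mean stable (exponentially stable in $p$th mean) if there exist $M>0$ and $\beta>0$ such that $E[\|x(k;x_0)\|^p]\le Me^{-\beta k}\|x_0\|^p$ for every $x_0\in\mathbb{R}^d$ and every $k\geq 0$. A Lyapunov function for $\Sigma_\mu$ is a continuous and positive definite function $V:\mathbb{R}^d\to\mathbb{R}$ (i.e. $V(0)=0$ and $V(x)>0$ for $x\ne0$) for which there exists $0\le\gamma<1$ such that $E[V(Ax)]\le\gamma V(x)$ for every $x\in\mathbb{R}^d$. It is homogeneous of degree $p$ if $V(\lambda x)=|\lambda|^pV(x)$ for all $\lambda\in\mathbb{R}$, $x\in\mathbb{R}^d$. Cones: a subset $K$ of a Euclidean space is a cone if it is closed under multiplication by nonnegative scalars; it is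 proper if it is closed, convex, solid (nonempty interior) and pointed ($x,-x\in K$ implies $x=0$). A set $\mathcal{M}$ of matrices leaves $K$ invariant if $MK\subset K$ for every $M\in\mathcal{M}$. For a square matrix $M$ acting on the ambient space of $K$, $M>^K0$ means that $M(K\setminus\{0\})\subset\operatorname{int}K$. $M^{\otimes p}$ denotes the $p$-fold Kronecker power of $M$. For a proper cone $K\subset\mathbb{R}^d$, $\tilde K_p:=\overline{\operatorname{conv}(K^{\otimes p})}\subset\mathbb{R}^{d^p}$ is the closed convex hull of $K^{\otimes p}=\{x_1\otimes\cdots\otimes x_p: x_1,\dots,x_p\in K\}$; it is a proper cone in $\mathbb{R}^{d^p}$, and $\tilde K_1=K$. *)

theory Defs
  imports "HOL-Probability.Probability"
begin

definition is_norm :: "('a::real_vector \<Rightarrow> real) \<Rightarrow> bool" where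
  "is_norm N \<longleftrightarrow>
     (\<forall>x. 0 \<le> N x) \<and> (\<forall>x. N x = 0 \<longleftrightarrow> x = 0) \<and>
     (\<forall>c x. N (c *\<^sub>R x) = \<bar>c\<bar> * N x) \<and> (\<forall>x y. N (x + y) \<le> N x + N y)"

definition measure_support :: "'a::topological_space measure \<Rightarrow> 'a set" where
  "measure_support \<mu> = {x. \<forall>U. open U \<longrightarrow> x \<in> U \<longrightarrow> 0 < emeasure \<mu> U}"

definition proper_cone :: "'a::euclidean_space set \<Rightarrow> bool" where
  "proper_cone K \<longleftrightarrow>
     cone K \<and> closed K \<and> convex K \<and> interior K \<noteq> {} \<and>
     (\<forall>x. x \<in> K \<and> - x \<in> K \<longrightarrow> x = 0)"

definition leaves_invariant :: "(real^'n^'n) set \<Rightarrow> (real^'n) set \<Rightarrow> bool" where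
  "leaves_invariant S K \<longleftrightarrow> (\<forall>B\<in>S. (\<lambda>x. B *v x) ` K \<subseteq> K)"

definition cone_positive :: "(real^'n) set \<Rightarrow> real^'n^'n \<Rightarrow> bool" where
  "cone_positive K B \<longleftrightarrow> (\<lambda>x. B *v x) ` (K - {0}) \<subseteq> interior K"

text \<open>
  For an index type \<open>'p\<close> with \<open>p\<close> elements (the tensor positions) and coordinates
  \<open>'n\<close> with \<open>d\<close> elements, the multi-indices \<open>'p \<Rightarrow> 'n\<close> number \<open>d^p\<close>, so
  \<open>real^('p \<Rightarrow> 'n)\<close> is the \<open>p\<close>-fold tensor power of \<open>real^'n\<close>. Compared with
  the Kronecker convention, only the enumeration of the coordinates is left unfixed.
\<close>

definition tensor_vec :: "('p::finite \<Rightarrow> real^'n) \<Rightarrow> real^('p \<Rightarrow> 'n::finite)" where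
  "tensor_vec x = (\<chi> i. \<Prod>k\<in>UNIV. x k $ i k)"

definition kron_power :: "real^'n^'n \<Rightarrow> real^('p::finite \<Rightarrow> 'n::finite)^('p \<Rightarrow> 'n)" where
  "kron_power B = (\<chi> i j. \<Prod>k\<in>UNIV. B $ i k $ j k)"

definition tensor_cone :: "(real^'n) set \<Rightarrow> (real^('p::finite \<Rightarrow> 'n::finite)) set" where
  "tensor_cone K = closure (convex hull (tensor_vec ` {x. \<forall>k. x k \<in> K}))"

primrec solution :: "(nat \<Rightarrow> real^'n^'n) \<Rightarrow> real^'n \<Rightarrow> nat \<Rightarrow> real^'n" where
  "solution B x0 0 = x0"
| "solution B x0 (Suc k) = B k *v solution B x0 k"

text \<open>
  A realization of the switched system: independent random matrices \<open>A k\<close> on a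
  probability space \<open>P\<close>, each with law \<open>\<mu>\<close>.
\<close>

definition switched_system ::
  "(real^'n^'n) measure \<Rightarrow> 'w measure \<Rightarrow> (nat \<Rightarrow> 'w \<Rightarrow> real^'n^'n) \<Rightarrow> bool" where
  "switched_system \<mu> P A \<longleftrightarrow>
     prob_space P \<and> prob_space.indep_vars P (\<lambda>_. borel) A UNIV \<and>
     (\<forall>k. distr P borel (A k) = \<mu>)"

text \<open>
  The integrability conditions in the next two definitions express that the
  expectations are finite; without them the Bochner integral of a non-integrable
  function would silently be \<open>0\<close>.
\<close>

definition mean_stable ::
  "(real^'n \<Rightarrow> real) \<Rightarrow> nat \<Rightarrow> 'w measure \<Rightarrow> (nat \<Rightarrow> 'w \<Rightarrow> real^'n^'n) \<Rightarrow> bool" where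
  "mean_stable N p P A \<longleftrightarrow>
     (\<exists>C>0. \<exists>\<beta>>0. \<forall>x0 k.
        integrable P (\<lambda>\<omega>. N (solution (\<lambda>j. A j \<omega>) x0 k) ^ p) \<and>
        (LINT \<omega>|P. N (solution (\<lambda>j. A j \<omega>) x0 k) ^ p)
          \<le> C * exp (- \<beta> * real k) * N x0 ^ p)"

definition lyapunov_function :: "(real^'n^'n) measure \<Rightarrow> (real^'n \<Rightarrow> real) \<Rightarrow> bool" where
  "lyapunov_function \<mu> V \<longleftrightarrow>
     continuous_on UNIV V \<and> V 0 = 0 \<and> (\<forall>x. x \<noteq> 0 \<longrightarrow> 0 < V x) \<and>
     (\<exists>\<gamma>. 0 \<le> \<gamma> \<and> \<gamma> < 1 \<and>
        (\<forall>x. integrable \<mu> (\<lambda>B. V (B *v x)) \<and> (LINT B|\<mu>. V (B *v x)) \<le> \<gamma> * V x))"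

definition homogeneous :: "nat \<Rightarrow> ('a::real_vector \<Rightarrow> real) \<Rightarrow> bool" where
  "homogeneous p V \<longleftrightarrow> (\<forall>c x. V (c *\<^sub>R x) = \<bar>c\<bar> ^ p * V x)"

end

theory Submission
  imports Defs
begin

text \<open>
  Write \<open>transition f x = E[f (A x)]\<close> for the operator by which one random matrix acts
  on functions of the state. By independence the moments of the solution are the
  iterates of this operator, \<open>E[f (x(k; x0))] = (transition ^^ k) f x0\<close>
  (\<open>expectation_solution\<close>), so that mean stability says that the iterates of the
  homogeneous function \<open>N ^ p\<close> decay geometrically, while a Lyapunov function is a
  function contracted by a single application of the operator.

  If the iterates decay, then their sum \<open>V = (\<Sum>k. (transition ^^ k) (N ^ p))\<close> is
  a Lyapunov function, because \<open>transition V = V - N ^ p\<close> and \<open>N ^ p\<close> is at least a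
  fixed fraction of \<open>V\<close> (\<open>lyapunov_function_of_decay\<close>). This is the converse
  Lyapunov theorem, with the sum along trajectories replaced by its expectation. If
  conversely a homogeneous \<open>V\<close> is contracted by \<open>\<gamma>\<close>, then its iterates decay like
  \<open>\<gamma> ^ k\<close>, and so do those of \<open>N ^ p\<close> (\<open>decay_of_lyapunov_function\<close>), because two
  continuous, positive definite, homogeneous functions of the same degree bound each
  other up to constants (\<open>homogeneous_comparison\<close>). Compactness of the support makes
  the operator preserve continuity and integrability.
\<close>

section \<open>Norms and homogeneous functions\<close>

lemma is_norm_continuous:
  fixes N :: "'a::euclidean_space \<Rightarrow> real"
  assumes "is_norm N"
  shows "continuous_on UNIV N"
proof -
  have N_nonneg: "0 \<le> N x" and N_zero: "N x = 0 \<longleftrightarrow> x = 0" and N_scale: "N (c *\<^sub>R x) = \<bar>c\<bar> * N x"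
    and N_add: "N (x + y) \<le> N x + N y" for c x y
    using assms unfolding is_norm_def by auto
  have N_sum: "N (\<Sum>i\<in>I. g i) \<le> (\<Sum>i\<in>I. N (g i))" if "finite I" for g :: "'a \<Rightarrow> 'a" and I
    using that
  proof induction
    case empty
    show ?case using N_zero[of 0] by simp
  next
    case (insert i I)
    then show ?case using N_add[of "g i" "\<Sum>i\<in>I. g i"] by simp
  qed
  define L where "L = (\<Sum>b\<in>(Basis::'a set). N b)"
  have bound: "N x \<le> L * norm x" for x
  proof -
    have "N x = N (\<Sum>b\<in>Basis. (x \<bullet> b) *\<^sub>R b)" by (simp add: euclidean_representation)
    also have "\<dots> \<le> (\<Sum>b\<in>Basis. N ((x \<bullet> b) *\<^sub>R b))" by (rule N_sum) simp
    also have "\<dots> \<le> (\<Sum>b\<in>Basis. norm x * N b)"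
      by (intro sum_mono) (simp add: N_scale N_nonneg Basis_le_norm mult_right_mono)
    finally show ?thesis by (simp add: L_def sum_distrib_left mult.commute)
  qed
  have diff: "N x - N y \<le> L * norm (x - y)" for x y
    using N_add[of "x - y" y] bound[of "x - y"] by simp
  have "L-lipschitz_on UNIV N"
  proof (rule lipschitz_onI)
    show "dist (N x) (N y) \<le> L * dist x y" for x y
      using diff[of x y] diff[of y x] by (simp add: dist_norm norm_minus_commute abs_le_iff)
    show "0 \<le> L" by (simp add: L_def N_nonneg sum_nonneg)
  qed
  then show ?thesis by (rule lipschitz_on_continuous_on)
qed

lemma homogeneous_zero:
  assumes "homogeneous p f" "0 < p"
  shows "f 0 = 0"
proof -
  have "f (0 *\<^sub>R 0) = \<bar>0\<bar> ^ p * f 0"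
    using assms(1) unfolding homogeneous_def by blast
  then show ?thesis using zero_power[OF assms(2), where 'a=real] by simp
qed

text \<open>
  By homogeneity it suffices to compare the two functions on the unit sphere, where
  compactness bounds their quotient.
\<close>

lemma homogeneous_comparison:
  fixes f h :: "'a::euclidean_space \<Rightarrow> real"
  assumes cont: "continuous_on UNIV f" "continuous_on UNIV h"
    and hom: "homogeneous p f" "homogeneous p h"
    and "0 < p"
    and h_pos: "\<And>x. x \<noteq> 0 \<Longrightarrow> 0 < h x"
  obtains c where "1 \<le> c" "\<And>x. f x \<le> c * h x"
proof -
  have "compact ((\<lambda>x. f x / h x) ` sphere 0 1)"
  proof (intro compact_continuous_image continuous_on_divide)
    show "continuous_on (sphere 0 1) f" "continuous_on (sphere 0 1) h"
      using cont continuous_on_subset by blast+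
    show "\<forall>x\<in>sphere 0 1. h x \<noteq> 0"
      using h_pos by (metis less_irrefl norm_zero mem_sphere_0 zero_neq_one)
  qed auto
  then obtain a where a: "\<And>x. x \<in> sphere 0 1 \<Longrightarrow> \<bar>f x / h x\<bar> \<le> a"
    by (force dest!: compact_imp_bounded simp: bounded_iff)
  have "f x \<le> max 1 a * h x" for x
  proof (cases "x = 0")
    case True
    then show ?thesis using hom[THEN homogeneous_zero, OF \<open>0 < p\<close>] by simp
  next
    case False
    define u where "u = x /\<^sub>R norm x"
    have u: "u \<in> sphere 0 1" "u \<noteq> 0" "x = norm x *\<^sub>R u"
      using False by (auto simp: u_def)
    have "f u / h u \<le> max 1 a" using a[OF u(1)] by linarith
    then have "f u \<le> max 1 a * h u" using h_pos[OF u(2)] by (simp add: divide_le_eq)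
    then have "norm x ^ p * f u \<le> max 1 a * (norm x ^ p * h u)"
      by (metis mult.left_commute mult_left_mono norm_ge_zero zero_le_power)
    moreover have "f x = norm x ^ p * f u" "h x = norm x ^ p * h u"
      using hom u(3) unfolding homogeneous_def by (metis abs_norm_cancel)+
    ultimately show ?thesis by simp
  qed
  then show thesis using that[of "max 1 a"] by simp
qed

section \<open>The support of a measure\<close>

text \<open>
  The complement of the support is a union of open null sets; second countability
  reduces this union to a countable one.
\<close>

lemma AE_measure_support:
  fixes \<mu> :: "'a::second_countable_topology measure"
  assumes sets: "sets \<mu> = sets borel"
  shows "AE x in \<mu>. x \<in> measure_support \<mu>"
proof -
  define F where "F = {U. open U \<and> emeasure \<mu> U = 0}"
  obtain F' where F': "F' \<subseteq> F" "countable F'" "\<Union>F' = \<Union>F"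
    by (rule Lindelof[of F]) (auto simp: F_def)
  have "(\<Union>U\<in>F'. U) \<in> null_sets \<mu>"
    using F' by (intro null_sets_UN') (auto simp: F_def null_sets_def sets)
  moreover have "\<Union>F = - measure_support \<mu>"
    by (auto simp: F_def measure_support_def zero_less_iff_neq_zero)
  ultimately have "- measure_support \<mu> \<in> null_sets \<mu>" using F' by simp
  from AE_not_in[OF this] show ?thesis by simp
qed

section \<open>The law of the solution\<close>

lemma continuous_on_matrix_vector_mult:
  fixes f :: "'a::topological_space \<Rightarrow> real^'n^'m"
  assumes "continuous_on S f" "continuous_on S g"
  shows "continuous_on S (\<lambda>z. f z *v g z)"
  unfolding matrix_vector_mult_def by (intro continuous_intros assms)

lemma measurable_solution:
  fixes A :: "nat \<Rightarrow> 'w \<Rightarrow> real^'n^'n"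
  assumes "\<And>j. j < k \<Longrightarrow> A j \<in> borel_measurable M"
  shows "(\<lambda>\<omega>. solution (\<lambda>j. A j \<omega>) x k) \<in> borel_measurable M"
  using assms
proof (induction k)
  case 0
  show ?case by simp
next
  case (Suc k)
  have "(\<lambda>z :: (real^'n^'n) \<times> (real^'n). fst z *v snd z) \<in> borel_measurable borel"
    by (intro borel_measurable_continuous_onI continuous_on_matrix_vector_mult continuous_intros)
  moreover have "(\<lambda>\<omega>. (A k \<omega>, solution (\<lambda>j. A j \<omega>) x k)) \<in> M \<rightarrow>\<^sub>M borel"
    using Suc by (intro borel_measurable_Pair) auto
  ultimately have "(\<lambda>\<omega>. fst (A k \<omega>, solution (\<lambda>j. A j \<omega>) x k)
      *v snd (A k \<omega>, solution (\<lambda>j. A j \<omega>) x k)) \<in> borel_measurable M"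
    by (rule measurable_compose[rotated])
  then show ?case by simp
qed

lemma solution_cong:
  assumes "\<And>j. j < k \<Longrightarrow> B j = B' j"
  shows "solution B x k = solution B' x k"
  using assms by (induction k) auto

lemma switched_system_measurable:
  assumes "switched_system \<mu> P A"
  shows "A j \<in> borel_measurable P"
proof -
  interpret P: prob_space P using assms by (simp add: switched_system_def)
  have "P.indep_vars (\<lambda>_. borel) A UNIV" using assms by (simp add: switched_system_def)
  then show ?thesis unfolding P.indep_vars_def2 by blast
qed

text \<open>
  The state at time \<open>k\<close> is a function of the matrices with index below \<open>k\<close> only;
  the product law expresses that \<open>A k\<close> is therefore independent of it.
\<close>

lemma distr_matrix_solution:
  fixes A :: "nat \<Rightarrow> 'w \<Rightarrow> real^'n^'n"
  assumes "prob_space P" "prob_space.indep_vars P (\<lambda>_. borel) A UNIV"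
  defines "X k x \<omega> \<equiv> solution (\<lambda>j. A j \<omega>) x k"
  shows "distr P (borel \<Otimes>\<^sub>M borel) (\<lambda>\<omega>. (A k \<omega>, X k x \<omega>))
    = distr P borel (A k) \<Otimes>\<^sub>M distr P borel (X k x)"
proof -
  interpret P: prob_space P by fact
  let ?M = "\<lambda>J :: nat set. PiM J (\<lambda>_. borel :: (real^'n^'n) measure)"
  let ?R = "\<lambda>J \<omega>. restrict (\<lambda>j. A j \<omega>) J"
  let ?f = "\<lambda>f. f k" and ?g = "\<lambda>f. solution f x k"
  have "P.indep_var (?M {k}) (?R {k}) (?M {..<k}) (?R {..<k})"
    by (rule P.indep_var_restrict[OF assms(2)]) auto
  then have R [measurable]: "?R {k} \<in> P \<rightarrow>\<^sub>M ?M {k}" "?R {..<k} \<in> P \<rightarrow>\<^sub>M ?M {..<k}"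
    and joint: "distr P (?M {k}) (?R {k}) \<Otimes>\<^sub>M distr P (?M {..<k}) (?R {..<k})
      = distr P (?M {k} \<Otimes>\<^sub>M ?M {..<k}) (\<lambda>\<omega>. (?R {k} \<omega>, ?R {..<k} \<omega>))"
    unfolding P.indep_var_distribution_eq by auto
  have f [measurable]: "?f \<in> ?M {k} \<rightarrow>\<^sub>M borel"
    by (rule measurable_component_singleton) simp
  have g [measurable]: "?g \<in> ?M {..<k} \<rightarrow>\<^sub>M borel"
    using measurable_solution[of k "\<lambda>j f. f j" "?M {..<k}" x] by simp
  have f_R: "?f (?R {k} \<omega>) = A k \<omega>" for \<omega> by simp
  have g_R: "?g (?R {..<k} \<omega>) = X k x \<omega>" for \<omega>
    unfolding X_def by (rule solution_cong) simp
  have distr_f: "distr (distr P (?M {k}) (?R {k})) borel ?f = distr P borel (A k)"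
    by (simp add: distr_distr[OF f R(1)] o_def)
  have distr_g: "distr (distr P (?M {..<k}) (?R {..<k})) borel ?g = distr P borel (X k x)"
    by (simp only: distr_distr[OF g R(2)] o_def g_R)
  have "X k x \<in> P \<rightarrow>\<^sub>M borel" using measurable_compose[OF R(2) g] by (simp only: g_R)
  then interpret X: prob_space "distr P borel (X k x)" by (rule P.prob_space_distr)
  have f': "?f \<in> distr P (?M {k}) (?R {k}) \<rightarrow>\<^sub>M borel"
    and g': "?g \<in> distr P (?M {..<k}) (?R {..<k}) \<rightarrow>\<^sub>M borel"
    using f g by (simp_all only: measurable_distr_eq1)
  have "distr P borel (A k) \<Otimes>\<^sub>M distr P borel (X k x)
      = distr (distr P (?M {k}) (?R {k}) \<Otimes>\<^sub>M distr P (?M {..<k}) (?R {..<k}))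
          (borel \<Otimes>\<^sub>M borel) (\<lambda>(u, v). (?f u, ?g v))"
    unfolding distr_f[symmetric] distr_g[symmetric]
    by (rule pair_measure_distr[OF f' g'])
      (simp only: distr_g X.sigma_finite_measure_axioms)
  also have "\<dots> = distr P (borel \<Otimes>\<^sub>M borel)
      ((\<lambda>(u, v). (?f u, ?g v)) \<circ> (\<lambda>\<omega>. (?R {k} \<omega>, ?R {..<k} \<omega>)))"
    unfolding joint by (rule distr_distr) (use R f g in measurable)
  finally show ?thesis by (simp only: o_def prod.case f_R g_R)
qed

section \<open>The transition operator of a random matrix\<close>

locale compact_matrix_law = prob_space \<mu> for \<mu> :: "(real^'n^'n) measure" +
  assumes sets_law [measurable_cong]: "sets \<mu> = sets borel"
    and compact_support: "compact (measure_support \<mu>)"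
begin

definition transition :: "(real^'n \<Rightarrow> real) \<Rightarrow> real^'n \<Rightarrow> real" where
  "transition f x = (LINT B|\<mu>. f (B *v x))"

lemma measurable_transition_integrand:
  fixes f :: "real^'n \<Rightarrow> real"
  assumes "continuous_on UNIV f"
  shows "(\<lambda>B. f (B *v x)) \<in> borel_measurable \<mu>"
proof -
  have "continuous_on UNIV (\<lambda>B :: real^'n^'n. f (B *v x))"
    by (rule continuous_on_compose2[OF assms])
      (auto intro!: continuous_on_matrix_vector_mult continuous_intros)
  then have "(\<lambda>B. f (B *v x)) \<in> borel_measurable borel" by (rule borel_measurable_continuous_onI)
  then show ?thesis using measurable_cong_sets[OF sets_law refl] by blast
qed

text \<open>
  Compactness of the support provides the constant dominating functions on which
  integrability and dominated convergence rest.
\<close>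

lemma transition_integrand_bounded:
  fixes f :: "real^'n \<Rightarrow> real"
  assumes "continuous_on UNIV f" "compact C"
  obtains b where "\<And>x. x \<in> C \<Longrightarrow> AE B in \<mu>. norm (f (B *v x)) \<le> b"
proof -
  have "continuous_on (measure_support \<mu> \<times> C) (\<lambda>z. f (fst z *v snd z))"
    by (rule continuous_on_compose2[OF assms(1)])
      (auto intro!: continuous_on_matrix_vector_mult continuous_intros)
  then have "compact ((\<lambda>z. f (fst z *v snd z)) ` (measure_support \<mu> \<times> C))"
    using compact_continuous_image compact_Times compact_support assms(2) by blast
  then obtain b where b: "\<And>B x. B \<in> measure_support \<mu> \<Longrightarrow> x \<in> C \<Longrightarrow> norm (f (B *v x)) \<le> b"
    by (force dest!: compact_imp_bounded simp: bounded_iff)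
  show thesis
  proof (rule that)
    fix x assume "x \<in> C"
    show "AE B in \<mu>. norm (f (B *v x)) \<le> b"
      using AE_measure_support[OF sets_law] by eventually_elim (rule b[OF _ \<open>x \<in> C\<close>])
  qed
qed

lemma integrable_transition_integrand:
  fixes f :: "real^'n \<Rightarrow> real"
  assumes "continuous_on UNIV f"
  shows "integrable \<mu> (\<lambda>B. f (B *v x))"
proof -
  obtain b where "\<And>y. y \<in> {x} \<Longrightarrow> AE B in \<mu>. norm (f (B *v y)) \<le> b"
    using transition_integrand_bounded[OF assms, of "{x}"] by auto
  then show ?thesis
    by (intro integrable_const_bound[where B=b] measurable_transition_integrand assms) auto
qed

lemma transition_continuous:
  assumes "continuous_on UNIV f"
  shows "continuous_on UNIV (transition f)"
  unfolding continuous_on_sequentially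
proof (intro allI ballI impI, elim conjE)
  fix X :: "nat \<Rightarrow> real^'n" and a assume lim: "X \<longlonglongrightarrow> a"
  obtain b where b: "\<And>y. y \<in> insert a (range X) \<Longrightarrow> AE B in \<mu>. norm (f (B *v y)) \<le> b"
    using transition_integrand_bounded[OF assms compact_sequence_with_limit[OF lim]] by auto
  have f_lim: "(\<lambda>n. f (B *v X n)) \<longlonglongrightarrow> f (B *v a)" for B :: "real^'n^'n"
  proof -
    have "continuous_on UNIV (\<lambda>x. f (B *v x))"
      by (rule continuous_on_compose2[OF assms])
        (auto intro!: continuous_on_matrix_vector_mult continuous_intros)
    then have "isCont (\<lambda>x. f (B *v x)) a" by (simp add: continuous_on_eq_continuous_at)
    then show ?thesis using lim by (rule isCont_tendsto_compose)
  qed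
  show "(transition f \<circ> X) \<longlonglongrightarrow> transition f a"
    unfolding transition_def o_def
  proof (rule integral_dominated_convergence[where w="\<lambda>_. b"])
    show "AE B in \<mu>. norm (f (B *v X n)) \<le> b" for n by (rule b) simp
    show "AE B in \<mu>. (\<lambda>n. f (B *v X n)) \<longlonglongrightarrow> f (B *v a)" by (rule AE_I2) (rule f_lim)
  qed (simp_all add: measurable_transition_integrand assms)
qed

lemma transition_nonneg:
  assumes "\<And>x. 0 \<le> f x"
  shows "0 \<le> transition f x"
  unfolding transition_def using assms by simp

lemma transition_homogeneous:
  assumes "homogeneous p f"
  shows "homogeneous p (transition f)"
  using assms unfolding homogeneous_def transition_def by (simp add: matrix_vector_mult_scaleR)

lemma nn_integral_transition:
  assumes "continuous_on UNIV f" "\<And>x. 0 \<le> f x"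
  shows "(\<integral>\<^sup>+B. ennreal (f (B *v x)) \<partial>\<mu>) = ennreal (transition f x)"
  unfolding transition_def
  using nn_integral_eq_integral[OF integrable_transition_integrand[OF assms(1)]] assms(2) by simp

lemma transition_power_regular:
  assumes "continuous_on UNIV f" "\<And>x. 0 \<le> f x" "homogeneous p f"
  shows "continuous_on UNIV ((transition ^^ k) f) \<and> (\<forall>x. 0 \<le> (transition ^^ k) f x) \<and>
    homogeneous p ((transition ^^ k) f)"
proof (induction k)
  case 0
  show ?case using assms by simp
next
  case (Suc k)
  then show ?case
    using transition_continuous[of "(transition ^^ k) f"] transition_nonneg[of "(transition ^^ k) f"]
      transition_homogeneous[of p "(transition ^^ k) f"] by simp
qed

lemma transition_power_le:
  assumes cont: "continuous_on UNIV V" and nonneg: "\<And>x. 0 \<le> V x"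
    and "0 \<le> \<gamma>" and step: "\<And>x. transition V x \<le> \<gamma> * V x"
  shows "(transition ^^ k) V x \<le> \<gamma> ^ k * V x"
proof -
  have "continuous_on UNIV ((transition ^^ k) V) \<and> (\<forall>x. (transition ^^ k) V x \<le> \<gamma> ^ k * V x)"
  proof (induction k)
    case 0
    show ?case using cont by simp
  next
    case (Suc k)
    have "transition ((transition ^^ k) V) x \<le> \<gamma> ^ Suc k * V x" for x
    proof -
      have "transition ((transition ^^ k) V) x \<le> (LINT B|\<mu>. \<gamma> ^ k * V (B *v x))"
        unfolding transition_def[of "(transition ^^ k) V"] using Suc cont
        by (intro integral_mono integrable_mult_right integrable_transition_integrand) auto
      also have "\<dots> = \<gamma> ^ k * transition V x" by (simp add: transition_def)
      also have "\<dots> \<le> \<gamma> ^ k * (\<gamma> * V x)" using step \<open>0 \<le> \<gamma>\<close> by (intro mult_left_mono) auto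
      finally show ?thesis by (simp add: mult_ac)
    qed
    then show ?case using Suc transition_continuous by simp
  qed
  then show ?thesis by simp
qed

section \<open>Moments of the solution\<close>

text \<open>
  This is the Markov property: conditioning on the state at time \<open>k\<close>, which is
  independent of the matrix applied next, replaces \<open>f\<close> by its image under the
  transition operator. Integrals of extended nonnegative functions make Tonelli's
  theorem available before integrability is known.
\<close>

lemma nn_integral_solution:
  assumes sys: "switched_system \<mu> P A"
    and "continuous_on UNIV f" "\<And>x. 0 \<le> f x"
  shows "(\<integral>\<^sup>+\<omega>. ennreal (f (solution (\<lambda>j. A j \<omega>) x k)) \<partial>P) = ennreal ((transition ^^ k) f x)"
  using assms(2,3)
proof (induction k arbitrary: f)
  case 0
  interpret P: prob_space P using sys by (simp add: switched_system_def)
  show ?case by (simp add: P.emeasure_space_1)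
next
  case (Suc k)
  interpret P: prob_space P using sys by (simp add: switched_system_def)
  let ?X = "\<lambda>\<omega>. solution (\<lambda>j. A j \<omega>) x k"
  have law: "distr P borel (A k) = \<mu>" using sys by (simp add: switched_system_def)
  note A [measurable] = switched_system_measurable[OF sys]
  have X [measurable]: "?X \<in> borel_measurable P" by (rule measurable_solution) (rule A)
  have pair: "\<mu> \<Otimes>\<^sub>M distr P borel ?X = distr P (borel \<Otimes>\<^sub>M borel) (\<lambda>\<omega>. (A k \<omega>, ?X \<omega>))"
    using distr_matrix_solution[of P A k x] sys law by (simp add: switched_system_def)
  interpret D: prob_space "distr P borel ?X" by (rule P.prob_space_distr[OF X])
  interpret pair_sigma_finite \<mu> "distr P borel ?X" ..
  have "continuous_on UNIV (\<lambda>z :: (real^'n^'n) \<times> (real^'n). f (fst z *v snd z))"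
    by (rule continuous_on_compose2[OF Suc.prems(1)])
      (auto intro!: continuous_on_matrix_vector_mult continuous_intros)
  then have "(\<lambda>z :: (real^'n^'n) \<times> (real^'n). f (fst z *v snd z)) \<in> borel_measurable borel"
    by (rule borel_measurable_continuous_onI)
  then have f_meas [measurable]:
    "(\<lambda>z :: (real^'n^'n) \<times> (real^'n). f (fst z *v snd z)) \<in> borel_measurable (borel \<Otimes>\<^sub>M borel)"
    by (simp add: borel_prod)
  have [measurable]: "transition f \<in> borel_measurable borel"
    using transition_continuous[OF Suc.prems(1)] by (rule borel_measurable_continuous_onI)
  have "(\<integral>\<^sup>+\<omega>. ennreal (f (solution (\<lambda>j. A j \<omega>) x (Suc k))) \<partial>P)
      = (\<integral>\<^sup>+z. ennreal (f (fst z *v snd z)) \<partial>(\<mu> \<Otimes>\<^sub>M distr P borel ?X))"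
    unfolding pair by (subst nn_integral_distr) auto
  also have "\<dots> = (\<integral>\<^sup>+y. (\<integral>\<^sup>+B. ennreal (f (B *v y)) \<partial>\<mu>) \<partial>distr P borel ?X)"
    by (subst nn_integral_snd[symmetric]) auto
  also have "\<dots> = (\<integral>\<^sup>+y. ennreal (transition f y) \<partial>distr P borel ?X)"
    by (simp add: nn_integral_transition Suc.prems)
  also have "\<dots> = (\<integral>\<^sup>+\<omega>. ennreal (transition f (?X \<omega>)) \<partial>P)"
    by (subst nn_integral_distr) auto
  also have "\<dots> = ennreal ((transition ^^ k) (transition f) x)"
    using Suc.prems by (intro Suc.IH transition_continuous transition_nonneg)
  finally show ?case by (simp add: funpow_Suc_right del: funpow.simps)
qed

lemma expectation_solution:
  assumes sys: "switched_system \<mu> P A"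
    and f: "continuous_on UNIV f" "\<And>x. 0 \<le> f x" "homogeneous p f"
  shows "has_bochner_integral P (\<lambda>\<omega>. f (solution (\<lambda>j. A j \<omega>) x k)) ((transition ^^ k) f x)"
proof (rule has_bochner_integral_nn_integral)
  show "(\<lambda>\<omega>. f (solution (\<lambda>j. A j \<omega>) x k)) \<in> borel_measurable P"
    by (rule measurable_compose[OF measurable_solution borel_measurable_continuous_onI[OF f(1)]])
      (rule switched_system_measurable[OF sys])
  show "0 \<le> (transition ^^ k) f x" using transition_power_regular[OF f] by blast
qed (use nn_integral_solution[OF sys f(1,2)] f(2) in auto)

section \<open>Stability and Lyapunov functions\<close>

lemma mean_stable_iff_transition_decay:
  assumes sys: "switched_system \<mu> P A" and "is_norm N"
  shows "mean_stable N p P A \<longleftrightarrow>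
    (\<exists>C>0. \<exists>\<beta>>0. \<forall>x k. (transition ^^ k) (\<lambda>y. N y ^ p) x \<le> C * exp (- \<beta> * real k) * N x ^ p)"
proof -
  have "continuous_on UNIV (\<lambda>y. N y ^ p)"
    by (intro continuous_intros is_norm_continuous assms)
  moreover have "0 \<le> N x ^ p" for x using \<open>is_norm N\<close> by (simp add: is_norm_def)
  moreover have "homogeneous p (\<lambda>y. N y ^ p)"
    using \<open>is_norm N\<close> by (simp add: is_norm_def homogeneous_def power_mult_distrib)
  ultimately have "has_bochner_integral P (\<lambda>\<omega>. N (solution (\<lambda>j. A j \<omega>) x k) ^ p)
      ((transition ^^ k) (\<lambda>y. N y ^ p) x)" for x k
    by (rule expectation_solution[OF sys])
  then show ?thesis
    unfolding mean_stable_def has_bochner_integral_iff by auto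
qed

text \<open>
  The function sought is the expected total cost \<open>V x = (\<Sum>k. (transition ^^ k) g x)\<close>
  incurred from \<open>x\<close> onwards. Geometric decay makes the series converge uniformly on
  bounded sets, so that \<open>V\<close> is continuous, and gives \<open>V \<le> c * g\<close>. Shifting the
  series by one step yields \<open>transition V = V - g\<close>, hence the contraction factor
  \<open>1 - 1 / c\<close>.
\<close>

lemma lyapunov_function_of_decay:
  assumes g: "continuous_on UNIV g" "homogeneous p g" "0 < p"
    and g_pos: "\<And>x. x \<noteq> 0 \<Longrightarrow> 0 < g x"
    and "0 < C" "0 < \<beta>"
    and decay: "\<And>x k. (transition ^^ k) g x \<le> C * exp (- \<beta> * real k) * g x"
  shows "\<exists>V. lyapunov_function \<mu> V \<and> homogeneous p V"
proof -
  define h where "h k = (transition ^^ k) g" for k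
  define V where "V x = (\<Sum>k. h k x)" for x
  have g0: "g 0 = 0" using homogeneous_zero g by blast
  have g_nonneg: "0 \<le> g x" for x using g0 g_pos[of x] by (cases "x = 0") auto
  have h_cont: "continuous_on UNIV (h k)" and h_nonneg: "0 \<le> h k x"
    and h_hom: "homogeneous p (h k)" for k x
    using transition_power_regular[OF g(1) g_nonneg g(2)] unfolding h_def by auto
  define r where "r = exp (- \<beta>)"
  have r: "0 < r" "r < 1" using \<open>0 < \<beta>\<close> by (auto simp: r_def)
  have h_le: "h k x \<le> C * g x * r ^ k" for k x
    using decay[of k x] by (simp add: h_def r_def exp_of_nat_mult[symmetric] mult_ac)
  have r_summable: "summable (\<lambda>k. a * r ^ k)" for a
    using r by (intro summable_mult summable_geometric) auto
  have h_summable: "summable (\<lambda>k. h k x)" for x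
    by (rule summable_comparison_test'[OF r_summable[of "C * g x"], of 0])
      (use h_nonneg h_le in auto)
  have V_cont: "continuous_on UNIV V"
  proof -
    have "continuous_on (cball 0 R) V" for R
    proof -
      have "compact (g ` cball 0 R)"
        by (intro compact_continuous_image continuous_on_subset[OF g(1)]) auto
      then obtain b where b: "\<And>x. x \<in> cball 0 R \<Longrightarrow> norm (g x) \<le> b"
        by (force dest!: compact_imp_bounded simp: bounded_iff)
      have "norm (h k x) \<le> C * b * r ^ k" if "x \<in> cball 0 R" for k x
      proof -
        have "C * g x * r ^ k \<le> C * b * r ^ k"
          using b[OF that] r \<open>0 < C\<close> by (intro mult_right_mono mult_left_mono) auto
        then show ?thesis using h_le[of k x] h_nonneg[of k x] by simp
      qed
      then have "uniform_limit (cball 0 R) (\<lambda>n x. \<Sum>k<n. h k x) V sequentially"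
        unfolding V_def by (rule Weierstrass_m_test[OF _ r_summable])
      then show ?thesis
        by (rule uniform_limit_theorem[rotated])
          (auto intro!: always_eventually continuous_on_sum continuous_on_subset[OF h_cont])
    qed
    then have "isCont V x" for x
      by (rule continuous_on_interior[of "cball 0 (norm x + 1)"]) (simp add: interior_cball)
    then show ?thesis by (simp add: continuous_at_imp_continuous_on)
  qed
  have V_hom: "homogeneous p V"
    using h_hom h_summable unfolding homogeneous_def V_def by (simp add: suminf_mult)
  have V_split: "V x = g x + (\<Sum>k. h (Suc k) x)" for x
    using suminf_split_head[OF h_summable[of x]] by (simp add: V_def h_def)
  have tail_summable: "summable (\<lambda>k. h (Suc k) x)" for x
    using h_summable[of x] summable_Suc_iff[of "\<lambda>k. h k x"] by blast
  have tail_nonneg: "0 \<le> (\<Sum>k. h (Suc k) x)" for x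
    by (rule suminf_nonneg[OF tail_summable h_nonneg])
  have V_ge: "g x \<le> V x" for x using V_split[of x] tail_nonneg[of x] by simp
  have V_nonneg: "0 \<le> V x" for x using V_ge[of x] g_nonneg[of x] by simp
  have transition_V: "transition V x = V x - g x" for x
  proof -
    have V_ennreal: "ennreal (V y) = (\<Sum>k. ennreal (h k y))" for y
      unfolding V_def using h_nonneg h_summable by (intro suminf_ennreal2[symmetric])
    have "ennreal (transition V x) = (\<integral>\<^sup>+B. (\<Sum>k. ennreal (h k (B *v x))) \<partial>\<mu>)"
      using nn_integral_transition[OF V_cont V_nonneg] by (simp add: V_ennreal)
    also have "\<dots> = (\<Sum>k. \<integral>\<^sup>+B. ennreal (h k (B *v x)) \<partial>\<mu>)"
      by (intro nn_integral_suminf measurable_compose[OF _ measurable_ennreal]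
          measurable_transition_integrand h_cont)
    also have "\<dots> = (\<Sum>k. ennreal (h (Suc k) x))"
      using nn_integral_transition[OF h_cont h_nonneg] by (simp add: h_def)
    also have "\<dots> = ennreal (\<Sum>k. h (Suc k) x)"
      by (rule suminf_ennreal2[OF h_nonneg tail_summable])
    finally have "transition V x = (\<Sum>k. h (Suc k) x)"
      using transition_nonneg[OF V_nonneg] tail_nonneg by simp
    then show ?thesis using V_split[of x] by simp
  qed
  obtain c where c: "1 \<le> c" "\<And>x. V x \<le> c * g x"
    using homogeneous_comparison[OF V_cont g(1) V_hom g(2,3) g_pos] by blast
  have "transition V x \<le> (1 - 1 / c) * V x" for x
  proof -
    have "V x / c \<le> g x" using c(1) c(2)[of x] by (simp add: divide_le_eq mult.commute)
    then show ?thesis by (simp add: transition_V algebra_simps)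
  qed
  moreover have "0 \<le> 1 - 1 / c" "1 - 1 / c < 1" using c(1) by (auto simp: divide_le_eq)
  moreover have "V x > 0" if "x \<noteq> 0" for x using V_ge[of x] g_pos[OF that] by simp
  moreover have "V 0 = 0" using homogeneous_zero[OF V_hom g(3)] .
  ultimately have "lyapunov_function \<mu> V"
    unfolding lyapunov_function_def transition_def[symmetric]
    using V_cont integrable_transition_integrand[OF V_cont] by blast
  then show ?thesis using V_hom by blast
qed

lemma decay_of_lyapunov_function:
  assumes V: "lyapunov_function \<mu> V" "homogeneous p V"
    and g: "continuous_on UNIV g" "homogeneous p g" "0 < p"
    and g_pos: "\<And>x. x \<noteq> 0 \<Longrightarrow> 0 < g x"
    and sys: "switched_system \<mu> P A"
  shows "\<exists>C>0. \<exists>\<beta>>0. \<forall>x k. (transition ^^ k) g x \<le> C * exp (- \<beta> * real k) * g x"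
proof -
  obtain \<gamma>' where V_cont: "continuous_on UNIV V" and V0: "V 0 = 0"
    and V_pos: "\<And>x. x \<noteq> 0 \<Longrightarrow> 0 < V x"
    and \<gamma>': "0 \<le> \<gamma>'" "\<gamma>' < 1" "\<And>x. transition V x \<le> \<gamma>' * V x"
    using V(1) unfolding lyapunov_function_def transition_def by blast
  have V_nonneg: "0 \<le> V x" for x using V0 V_pos[of x] by (cases "x = 0") auto
  have g_nonneg: "0 \<le> g x" for x
    using homogeneous_zero[OF g(2,3)] g_pos[of x] by (cases "x = 0") auto
  \<comment> \<open>The contraction factor may vanish, in which case it has no logarithm.\<close>
  define \<gamma> where "\<gamma> = max \<gamma>' (1 / 2)"
  have \<gamma>: "0 < \<gamma>" "\<gamma> < 1" using \<gamma>'(2) by (auto simp: \<gamma>_def)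
  have step: "transition V x \<le> \<gamma> * V x" for x
    using \<gamma>'(3)[of x] mult_right_mono[OF _ V_nonneg[of x], of \<gamma>' \<gamma>] by (simp add: \<gamma>_def)
  obtain c where c: "1 \<le> c" "\<And>x. g x \<le> c * V x"
    using homogeneous_comparison[OF g(1) V_cont g(2) V(2) g(3) V_pos] by blast
  obtain d where d: "1 \<le> d" "\<And>x. V x \<le> d * g x"
    using homogeneous_comparison[OF V_cont g(1) V(2) g(2,3) g_pos] by blast
  have bound: "(transition ^^ k) g x \<le> (c * d) * exp (- (- ln \<gamma>) * real k) * g x" for x k
  proof -
    have g_le: "(transition ^^ k) g x \<le> c * (transition ^^ k) V x"
    proof -
      let ?X = "\<lambda>\<omega>. solution (\<lambda>j. A j \<omega>) x k"
      have g_int: "has_bochner_integral P (\<lambda>\<omega>. g (?X \<omega>)) ((transition ^^ k) g x)"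
        by (rule expectation_solution[OF sys g(1) g_nonneg g(2)])
      have "has_bochner_integral P (\<lambda>\<omega>. V (?X \<omega>)) ((transition ^^ k) V x)"
        by (rule expectation_solution[OF sys V_cont V_nonneg V(2)])
      then have V_int: "has_bochner_integral P (\<lambda>\<omega>. c * V (?X \<omega>)) (c * (transition ^^ k) V x)"
        by (rule has_bochner_integral_mult_right)
      have "(LINT \<omega>|P. g (?X \<omega>)) \<le> (LINT \<omega>|P. c * V (?X \<omega>))"
        using g_int V_int by (intro integral_mono c(2)) (simp_all only: has_bochner_integral_iff)
      then show ?thesis
        using g_int V_int by (simp only: has_bochner_integral_iff)
    qed
    also have "c * (transition ^^ k) V x \<le> c * (\<gamma> ^ k * V x)"
      using c(1) \<gamma>(1) by (intro mult_left_mono transition_power_le V_cont V_nonneg step) auto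
    also have "\<dots> \<le> c * (\<gamma> ^ k * (d * g x))"
      using c(1) \<gamma>(1) d(2) by (intro mult_left_mono) auto
    also have "\<gamma> ^ k = exp (- (- ln \<gamma>) * real k)"
      using \<gamma>(1) by (simp add: exp_of_nat2_mult)
    finally show ?thesis by (simp add: mult_ac)
  qed
  moreover have "0 < c * d" "0 < - ln \<gamma>" using c(1) d(1) \<gamma> by auto
  ultimately show ?thesis by blast
qed

end

theorem mainTheorem1:
  fixes p :: nat
    and \<mu> :: "(real^'n^'n) measure"
    and N :: "real^'n \<Rightarrow> real"
    and P :: "'w measure"
    and A :: "nat \<Rightarrow> 'w \<Rightarrow> real^'n^'n"
  assumes "p = CARD('p::finite)"
    and "prob_space \<mu>" and "sets \<mu> = sets borel"
    and "compact (measure_support \<mu>)"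
    and "is_norm N"
    and "switched_system \<mu> P A"
    and "even p \<or>
         (\<exists>K :: (real^'n) set. proper_cone K \<and> leaves_invariant (measure_support \<mu>) K \<and>
            cone_positive (tensor_cone K :: (real^('p \<Rightarrow> 'n)) set)
              (LINT B|\<mu>. kron_power B))"
  shows "mean_stable N p P A \<longleftrightarrow> (\<exists>V. lyapunov_function \<mu> V \<and> homogeneous p V)"
proof -
  interpret compact_matrix_law \<mu>
    using assms(2-4) by (intro compact_matrix_law.intro compact_matrix_law_axioms.intro)
  have "0 < p" using assms(1) by simp
  have N_cont: "continuous_on UNIV (\<lambda>y. N y ^ p)"
    by (intro continuous_intros is_norm_continuous assms(5))
  have N_hom: "homogeneous p (\<lambda>y. N y ^ p)"
    using assms(5) by (simp add: is_norm_def homogeneous_def power_mult_distrib)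
  have N_pos: "0 < N x ^ p" if "x \<noteq> 0" for x
  proof -
    have "0 \<le> N x" "N x \<noteq> 0" using assms(5) that unfolding is_norm_def by blast+
    then show ?thesis by simp
  qed
  show ?thesis
    unfolding mean_stable_iff_transition_decay[OF assms(6,5)]
  proof (intro iffI; elim exE conjE)
    fix C \<beta> :: real
    assume "0 < C" "0 < \<beta>"
      and "\<forall>x k. (transition ^^ k) (\<lambda>y. N y ^ p) x \<le> C * exp (- \<beta> * real k) * N x ^ p"
    then show "\<exists>V. lyapunov_function \<mu> V \<and> homogeneous p V"
      by (intro lyapunov_function_of_decay[OF N_cont N_hom \<open>0 < p\<close> N_pos]) blast+
  next
    fix V assume "lyapunov_function \<mu> V" "homogeneous p V"
    then show "\<exists>C>0. \<exists>\<beta>>0. \<forall>x k.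
        (transition ^^ k) (\<lambda>y. N y ^ p) x \<le> C * exp (- \<beta> * real k) * N x ^ p"
      by (rule decay_of_lyapunov_function[OF _ _ N_cont N_hom \<open>0 < p\<close> N_pos assms(6)])
  qed
qed

end
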